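(* Every $n$-dimensional dyadic polytope is finitely generated as a groupoid under the operation $x\circ y=\tfrac12(x+y)$.
   Context: $\mathbb D=\mathbb Z[1/2]$ is the ring of dyadic rationals, and $\mathbb D^n\subseteq\mathbb R^n$. A dyadic $n$-dimensional polytope is a set of the form $Q\cap\mathbb D^n$, where $Q\subseteq\mathbb R^n$ is an $n$-dimensional real convex polytope (convex hull of finitely many points) all of whose vertices lie in $\mathbb D^n$. It is closed under the arithmetic mean operation $x\circ y=\tfrac12(x+y)$. A subset $X$ generates it as a groupoid if it is the smallest subset containing $X$ and closed under $\circ$; it is finitely generated if such a finite $X$ exists. *)

theory Defs
  imports "HOL-Analysis.Analysis"
begin

definition dyadic :: "real set"
  where "dyadic = {of_int a / 2 ^ k | (a :: int) (k :: nat). True}"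

definition dyadic_space :: "(real ^ 'n) set"
  where "dyadic_space = {x. \<forall>i. x $ i \<in> dyadic}"

text \<open>Full-dimensional in \<open>real ^ 'n\<close>, where \<open>n = CARD('n)\<close>; the vertices of a polytope
  are its extreme points.\<close>

definition dyadic_polytope :: "(real ^ 'n) set \<Rightarrow> bool"
  where "dyadic_polytope P \<longleftrightarrow>
    (\<exists>Q. polytope Q \<and> aff_dim Q = int CARD('n) \<and>
         (\<forall>v. v extreme_point_of Q \<longrightarrow> v \<in> dyadic_space) \<and>
         P = Q \<inter> dyadic_space)"

text \<open>The operation \<open>x \<circ> y\<close> is the library's \<open>midpoint x y = inverse 2 *\<^sub>R (x + y)\<close>.\<close>

definition mean_closed :: "'a::real_vector set \<Rightarrow> bool"
  where "mean_closed S \<longleftrightarrow> (\<forall>x\<in>S. \<forall>y\<in>S. midpoint x y \<in> S)"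

text \<open>\<open>mean_closed hull X\<close> is the intersection of all mean-closed sets containing \<open>X\<close>.\<close>

definition finitely_generated_groupoid :: "'a::real_vector set \<Rightarrow> bool"
  where "finitely_generated_groupoid P \<longleftrightarrow>
    (\<exists>X. finite X \<and> X \<subseteq> P \<and> mean_closed hull X = P)"

end

theory Submission imports Defs
begin

text \<open>
  Let \<open>Q\<close> be the convex hull of a finite set \<open>V\<close> of dyadic points.  The dyadic points are the
  increasing union of the grids \<open>2\<^sup>-\<^sup>m \<int>\<^sup>n\<close>, so it suffices to show that, once \<open>m\<close> is large, every
  point \<open>x\<close> of \<open>Q\<close> in the grid of level \<open>m + 1\<close> is the midpoint of two points of \<open>Q\<close> in the
  grid of level \<open>m\<close>: then the finitely many points of \<open>Q\<close> in one sufficiently fine grid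
  generate all of its dyadic points, by induction on the level.

  After scaling by \<open>2\<^sup>m\<close> this is an integer decomposition property: a lattice point of a doubled
  polytope is a sum of two lattice points of the polytope.  It holds for large multiples by
  rounding.  Suppose \<open>V\<close> lies in the grid of level \<open>k\<close>, put \<open>K = 2\<^sup>m\<^sup>-\<^sup>k\<close>, and write
  \<open>x = (\<Sum>v\<in>V. l v *\<^sub>R v)\<close> as a convex combination.  The integer parts of the numbers \<open>2 * K * l v\<close>
  have sum at least \<open>2 * K - card V\<close>, which is at least \<open>K\<close> as soon as \<open>K \<ge> card V\<close>.  Below these
  integer parts there are therefore natural numbers \<open>g v\<close> with sum exactly \<open>K\<close>.  The point
  \<open>y = (\<Sum>v\<in>V. (g v / K) *\<^sub>R v)\<close> is in \<open>Q\<close> and in the grid of level \<open>m\<close>, and so is its mirror image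
  \<open>2 *\<^sub>R x - y\<close>, whose coefficients \<open>2 * l v - g v / K\<close> are nonnegative with sum 1.
\<close>

section \<open>Grids of dyadic points\<close>

definition dyadic_grid :: "nat \<Rightarrow> (real ^ 'n) set"
  where "dyadic_grid m = {x. \<forall>i. 2 ^ m * x $ i \<in> \<int>}"

lemma power_mult_Ints_mono:
  fixes r :: real
  assumes "m \<le> m'" "2 ^ m * r \<in> \<int>"
  shows "2 ^ m' * r \<in> \<int>"
proof -
  have "(2::real) ^ m' = 2 ^ (m' - m) * 2 ^ m"
    using assms(1) by (simp flip: power_add)
  then have "2 ^ m' * r = 2 ^ (m' - m) * (2 ^ m * r)"
    by (simp only: mult.assoc)
  also have "\<dots> \<in> \<int>"
    by (intro Ints_mult assms(2)) auto
  finally show ?thesis .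
qed

lemma dyadic_grid_mono: "m \<le> m' \<Longrightarrow> dyadic_grid m \<subseteq> dyadic_grid m'"
  by (auto simp: dyadic_grid_def intro: power_mult_Ints_mono)

lemma dyadic_grid_diff:
  "x \<in> dyadic_grid m \<Longrightarrow> y \<in> dyadic_grid m \<Longrightarrow> x - y \<in> dyadic_grid m"
  by (simp add: dyadic_grid_def right_diff_distrib)

lemma dyadic_iff_power_mult_Ints: "r \<in> dyadic \<longleftrightarrow> (\<exists>m. 2 ^ m * r \<in> \<int>)"
proof
  assume "r \<in> dyadic"
  then obtain a k where "r = of_int a / 2 ^ k"
    by (auto simp: dyadic_def)
  then have "2 ^ k * r = of_int a" by simp
  then show "\<exists>m. 2 ^ m * r \<in> \<int>"
    by (metis Ints_of_int)
next
  assume "\<exists>m. 2 ^ m * r \<in> \<int>"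
  then obtain m a where "2 ^ m * r = of_int a"
    by (auto elim: Ints_cases)
  then have "r = of_int a / 2 ^ m"
    by (simp add: field_simps)
  then show "r \<in> dyadic"
    by (auto simp: dyadic_def)
qed

lemma dyadic_space_eq_Union_grid: "(dyadic_space :: (real ^ 'n) set) = (\<Union>m. dyadic_grid m)"
proof (intro equalityI subsetI)
  fix x :: "real ^ 'n"
  assume "x \<in> dyadic_space"
  then have "\<forall>i. \<exists>m. 2 ^ m * x $ i \<in> \<int>"
    by (simp add: dyadic_space_def dyadic_iff_power_mult_Ints)
  then obtain e where e: "\<And>i. 2 ^ e i * x $ i \<in> \<int>"
    by metis
  have "2 ^ Max (range e) * x $ i \<in> \<int>" for i
    by (rule power_mult_Ints_mono[OF _ e]) simp
  then show "x \<in> (\<Union>m. dyadic_grid m)"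
    by (auto simp: dyadic_grid_def)
next
  fix x :: "real ^ 'n"
  assume "x \<in> (\<Union>m. dyadic_grid m)"
  then show "x \<in> dyadic_space"
    by (auto simp: dyadic_grid_def dyadic_space_def dyadic_iff_power_mult_Ints)
qed

lemma finite_subset_dyadic_space_grid:
  assumes "finite V" "V \<subseteq> dyadic_space"
  obtains k where "V \<subseteq> dyadic_grid k"
  using assms
proof (induction V arbitrary: thesis)
  case empty
  then show ?case by blast
next
  case (insert v V)
  then obtain k where "V \<subseteq> dyadic_grid k" by blast
  moreover obtain j where "v \<in> dyadic_grid j"
    using insert.prems by (auto simp: dyadic_space_eq_Union_grid)
  ultimately have "insert v V \<subseteq> dyadic_grid (max k j)"
    using dyadic_grid_mono[of k "max k j"] dyadic_grid_mono[of j "max k j"] by auto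
  then show ?case by (rule insert.prems)
qed

lemma midpoint_dyadic_grid:
  assumes "x \<in> dyadic_grid m" "y \<in> dyadic_grid m"
  shows "midpoint x y \<in> dyadic_grid (Suc m)"
  using assms by (simp add: dyadic_grid_def midpoint_def distrib_left)

lemma mean_closed_dyadic_space: "mean_closed (dyadic_space :: (real ^ 'n) set)"
  unfolding mean_closed_def
proof (intro ballI)
  fix x y :: "real ^ 'n"
  assume "x \<in> dyadic_space" "y \<in> dyadic_space"
  then obtain k where "x \<in> dyadic_grid k" "y \<in> dyadic_grid k"
    using finite_subset_dyadic_space_grid[of "{x, y}"] by auto
  then show "midpoint x y \<in> dyadic_space"
    using midpoint_dyadic_grid by (auto simp: dyadic_space_eq_Union_grid)
qed

lemma mean_closed_convex: "convex S \<Longrightarrow> mean_closed S"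
  unfolding mean_closed_def
  by (meson closed_segment_subset midpoint_in_closed_segment subsetD)

lemma finite_bounded_Int_dyadic_grid:
  fixes S :: "(real ^ 'n) set"
  assumes "bounded S"
  shows "finite (S \<inter> dyadic_grid m)"
proof -
  obtain B where B: "\<And>x. x \<in> S \<Longrightarrow> norm x \<le> B"
    using assms by (auto simp: bounded_iff)
  define A :: "real set" where "A = (\<lambda>a. a / 2 ^ m) ` {a \<in> \<int>. \<bar>a\<bar> \<le> 2 ^ m * B}"
  have "finite A"
    unfolding A_def by (intro finite_imageI finite_abs_int_segment)
  then have "finite (vec_lambda ` (PiE UNIV (\<lambda>_ :: 'n. A)))"
    by (intro finite_imageI finite_PiE) auto
  moreover have "S \<inter> dyadic_grid m \<subseteq> vec_lambda ` (PiE UNIV (\<lambda>_. A))"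
  proof
    fix x assume x: "x \<in> S \<inter> dyadic_grid m"
    have "x $ i \<in> A" for i
    proof -
      have "\<bar>x $ i\<bar> \<le> B"
        using component_le_norm_cart[of x i] B[of x] x by auto
      then have "\<bar>2 ^ m * x $ i\<bar> \<le> 2 ^ m * B"
        by (simp add: abs_mult)
      moreover have "2 ^ m * x $ i \<in> \<int>"
        using x by (simp add: dyadic_grid_def)
      ultimately show ?thesis
        unfolding A_def by (intro image_eqI[of _ _ "2 ^ m * x $ i"]) auto
    qed
    then show "x \<in> vec_lambda ` (PiE UNIV (\<lambda>_. A))"
      by (intro image_eqI[of _ _ "\<lambda>i. x $ i"]) (auto simp: vec_nth_inverse)
  qed
  ultimately show ?thesis
    by (rule finite_subset[rotated])
qed

section \<open>Splitting grid points of a polytope\<close>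

lemma sum_nat_exact_below:
  fixes f :: "'a \<Rightarrow> nat"
  assumes "finite A" "K \<le> sum f A"
  obtains g where "\<And>a. a \<in> A \<Longrightarrow> g a \<le> f a" "sum g A = K"
  using assms
proof (induction A arbitrary: K thesis)
  case empty
  then show ?case by simp
next
  case (insert a A)
  have "K - min K (f a) \<le> sum f A"
    using insert.hyps insert.prems(2) by auto
  then obtain g where g: "\<And>b. b \<in> A \<Longrightarrow> g b \<le> f b" "sum g A = K - min K (f a)"
    using insert.IH by blast
  have "sum (g(a := min K (f a))) (insert a A) = min K (f a) + sum g A"
    using insert.hyps by (simp add: sum.insert) (intro sum.cong, auto)
  with g insert.hyps show ?case
    by (intro insert.prems(1)[of "g(a := min K (f a))"]) auto
qed

text \<open>
  Rounding \<open>2 * K * l v\<close> down loses less than one unit for each of the \<open>card V\<close> weights, so at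
  least \<open>2 * K - card V \<ge> K\<close> units remain, from which exactly \<open>K\<close> can be picked.
\<close>

lemma natural_weights_below_double:
  fixes l :: "'a \<Rightarrow> real"
  assumes "finite V" and nonneg: "\<And>v. v \<in> V \<Longrightarrow> 0 \<le> l v" and sum1: "sum l V = 1"
    and K: "card V \<le> K"
  obtains g :: "'a \<Rightarrow> nat"
    where "sum g V = K" "\<And>v. v \<in> V \<Longrightarrow> real (g v) \<le> 2 * real K * l v"
proof -
  define f where "f v = nat \<lfloor>2 * real K * l v\<rfloor>" for v
  have f: "real (f v) \<le> 2 * real K * l v" "2 * real K * l v - 1 \<le> real (f v)" if "v \<in> V" for v
  proof -
    have "0 \<le> 2 * real K * l v" using nonneg[OF that] by simp
    then show "real (f v) \<le> 2 * real K * l v" "2 * real K * l v - 1 \<le> real (f v)"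
      unfolding f_def by linarith+
  qed
  have "2 * real K - card V = (\<Sum>v\<in>V. 2 * real K * l v - 1)"
    using sum1 by (simp add: sum_subtractf sum_distrib_left[symmetric])
  also have "\<dots> \<le> (\<Sum>v\<in>V. real (f v))"
    by (intro sum_mono f)
  finally have "K \<le> sum f V"
    using K by (simp flip: of_nat_sum)
  then obtain g where g: "\<And>v. v \<in> V \<Longrightarrow> g v \<le> f v" "sum g V = K"
    using sum_nat_exact_below[OF \<open>finite V\<close>] by blast
  then show thesis
    using f(1) by (intro that[of g]) (auto intro: order_trans[OF of_nat_mono])
qed

text \<open>
  The weights \<open>g v / K\<close> of one half \<open>y\<close> have denominator \<open>2\<^sup>m\<^sup>-\<^sup>k\<close> and the vertices lie in the grid
  of level \<open>k\<close>, so \<open>y\<close> lies in the grid of level \<open>m\<close>.  The other half inherits this because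
  \<open>2 *\<^sub>R x\<close> is already on that grid, whatever the denominators of the weights of \<open>x\<close> may be: these
  need not be dyadic.
\<close>

lemma dyadic_grid_split:
  fixes V :: "(real ^ 'n) set"
  assumes V: "finite V" "V \<subseteq> dyadic_grid k"
    and m: "k \<le> m" "card V \<le> 2 ^ (m - k)"
    and x: "x \<in> convex hull V" "x \<in> dyadic_grid (Suc m)"
  obtains y z where "y \<in> convex hull V \<inter> dyadic_grid m" "z \<in> convex hull V \<inter> dyadic_grid m"
    "x = midpoint y z"
proof -
  define K :: nat where "K = 2 ^ (m - k)"
  have K0: "0 < real K" by (simp add: K_def)
  obtain l where l: "\<And>v. v \<in> V \<Longrightarrow> 0 \<le> l v" "sum l V = 1" "(\<Sum>v\<in>V. l v *\<^sub>R v) = x"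
    using x(1) by (auto simp: convex_hull_finite[OF V(1)])
  obtain g :: "real ^ 'n \<Rightarrow> nat"
    where g: "sum g V = K" "\<And>v. v \<in> V \<Longrightarrow> real (g v) \<le> 2 * real K * l v"
    using natural_weights_below_double[OF V(1) l(1,2) m(2)] unfolding K_def by blast
  have gsum: "(\<Sum>v\<in>V. real (g v) / real K) = 1"
    using g(1) K0 by (simp flip: sum_divide_distrib of_nat_sum)
  define y where "y = (\<Sum>v\<in>V. (real (g v) / real K) *\<^sub>R v)"
  define z where "z = 2 *\<^sub>R x - y"
  have "y \<in> convex hull V"
    unfolding y_def using V(1) gsum
    by (intro convex_sum) (auto simp: hull_inc)
  moreover have "z \<in> convex hull V"
  proof -
    have "z = (\<Sum>v\<in>V. (2 * l v - real (g v) / real K) *\<^sub>R v)"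
      by (simp add: z_def y_def l(3)[symmetric] scaleR_diff_left sum_subtractf scaleR_right.sum)
    also have "\<dots> \<in> convex hull V"
    proof (intro convex_sum)
      show "(\<Sum>v\<in>V. 2 * l v - real (g v) / real K) = 1"
        using l(2) gsum by (simp add: sum_subtractf sum_distrib_left[symmetric])
      show "0 \<le> 2 * l v - real (g v) / real K" if "v \<in> V" for v
        using g(2)[OF that] K0 by (simp add: field_simps)
    qed (use V(1) in \<open>auto simp: hull_inc\<close>)
    finally show ?thesis .
  qed
  moreover have y: "y \<in> dyadic_grid m"
  proof -
    have "2 ^ m * y $ i \<in> \<int>" for i
    proof -
      have "(2::real) ^ m = 2 ^ k * real K"
        using m(1) by (simp add: K_def power_add[symmetric])
      then have "2 ^ m * y $ i = (\<Sum>v\<in>V. real (g v) * (2 ^ k * v $ i))"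
        using K0 by (simp add: y_def sum_distrib_left mult_ac)
      also have "\<dots> \<in> \<int>"
        using V(2) by (intro Ints_sum Ints_mult[OF Ints_of_nat]) (auto simp: dyadic_grid_def)
      finally show ?thesis .
    qed
    then show ?thesis by (simp add: dyadic_grid_def)
  qed
  moreover have "z \<in> dyadic_grid m"
  proof -
    have "2 *\<^sub>R x \<in> dyadic_grid m"
      using x(2) by (simp add: dyadic_grid_def mult_ac)
    then show ?thesis
      unfolding z_def using y by (rule dyadic_grid_diff)
  qed
  moreover have "x = midpoint y z"
    by (simp add: z_def midpoint_def)
  ultimately show thesis
    by (intro that) auto
qed

section \<open>Finite generation\<close>

text \<open>
  Any level \<open>m\<close> with \<open>card V \<le> 2\<^sup>m\<^sup>-\<^sup>k\<close> provides a generating set, since the splitting step then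
  applies at every level above \<open>m\<close> as well.
\<close>

lemma finitely_generated_convex_hull_Int_dyadic_space:
  fixes V :: "(real ^ 'n) set"
  assumes V: "finite V" "V \<subseteq> dyadic_space"
  shows "finitely_generated_groupoid (convex hull V \<inter> dyadic_space)"
proof -
  let ?Q = "convex hull V"
  obtain k where k: "V \<subseteq> dyadic_grid k"
    using V by (rule finite_subset_dyadic_space_grid)
  define m where "m = k + card V"
  define X where "X = ?Q \<inter> dyadic_grid m"
  have "finite X"
    unfolding X_def using V(1)
    by (intro finite_bounded_Int_dyadic_grid bounded_convex_hull finite_imp_bounded)
  moreover have X: "X \<subseteq> ?Q \<inter> dyadic_space"
    by (auto simp: X_def dyadic_space_eq_Union_grid)
  moreover have "mean_closed hull X = ?Q \<inter> dyadic_space"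
  proof (rule hull_unique)
    show "X \<subseteq> ?Q \<inter> dyadic_space" by (fact X)
    show "mean_closed (?Q \<inter> dyadic_space)"
      using mean_closed_convex[OF convex_convex_hull, of V] mean_closed_dyadic_space
      by (auto simp: mean_closed_def)
    show "?Q \<inter> dyadic_space \<subseteq> S" if "X \<subseteq> S" "mean_closed S" for S
    proof -
      have level: "?Q \<inter> dyadic_grid (m + j) \<subseteq> S" for j
      proof (induction j)
        case 0
        then show ?case using \<open>X \<subseteq> S\<close> by (simp add: X_def)
      next
        case (Suc j)
        have "card V \<le> 2 ^ card V"
          by (rule less_imp_le[OF less_exp])
        also have "\<dots> \<le> 2 ^ (m + j - k)"
          by (intro power_increasing) (auto simp: m_def)
        finally have "card V \<le> 2 ^ (m + j - k)" .
        show ?case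
        proof
          fix x assume "x \<in> ?Q \<inter> dyadic_grid (m + Suc j)"
          then have x: "x \<in> ?Q" "x \<in> dyadic_grid (Suc (m + j))" by auto
          have "k \<le> m + j" by (simp add: m_def)
          then obtain y z where "y \<in> ?Q \<inter> dyadic_grid (m + j)" "z \<in> ?Q \<inter> dyadic_grid (m + j)"
            and "x = midpoint y z"
            using dyadic_grid_split[OF V(1) k _ \<open>card V \<le> 2 ^ (m + j - k)\<close> x] by metis
          then show "x \<in> S"
            using Suc.IH \<open>mean_closed S\<close> by (auto simp: mean_closed_def)
        qed
      qed
      show ?thesis
      proof
        fix x assume x: "x \<in> ?Q \<inter> dyadic_space"
        then obtain j where "x \<in> dyadic_grid j"
          by (auto simp: dyadic_space_eq_Union_grid)
        then have "x \<in> dyadic_grid (m + j)"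
          using dyadic_grid_mono[of j "m + j"] by auto
        with x level show "x \<in> S" by auto
      qed
    qed
  qed
  ultimately show ?thesis
    by (auto simp: finitely_generated_groupoid_def)
qed

theorem theorem3p4:
  fixes P :: "(real ^ 'n) set"
  assumes "dyadic_polytope P"
  shows "finitely_generated_groupoid P"
proof -
  obtain Q where Q: "polytope Q" "\<And>v. v extreme_point_of Q \<Longrightarrow> v \<in> dyadic_space"
    and P: "P = Q \<inter> dyadic_space"
    using assms by (auto simp: dyadic_polytope_def)
  define V where "V = {v. v extreme_point_of Q}"
  have "finite V"
    unfolding V_def using Q(1) by (intro finite_polyhedron_extreme_points polytope_imp_polyhedron)
  moreover have "V \<subseteq> dyadic_space"
    using Q(2) by (auto simp: V_def)
  moreover have "Q = convex hull V"
    unfolding V_def using Q(1)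
    by (intro Krein_Milman_Minkowski polytope_imp_compact polytope_imp_convex)
  ultimately show ?thesis
    using finitely_generated_convex_hull_Int_dyadic_space P by metis
qed

end
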